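(* Let $\mathcal{H}$ be a complex Hilbert space, let $A$ be a subnormal bounded linear operator on $\mathcal{H}$, and let $n,\kappa$ be integers greater than $1$. Assume that $T=A^n$ satisfies the single equation $$T^{*\kappa}T^{\kappa}=(T^*T)^{\kappa}.$$ Then $A$ is quasinormal.
   Context: All operators are bounded linear operators on complex Hilbert spaces (not assumed separable). An operator $A$ on $\mathcal{H}$ is subnormal if it is (unitarily equivalent to) the restriction of a normal operator to a closed invariant subspace; that is, up to unitary equivalence, there are a Hilbert space $\mathcal{K}\supseteq\mathcal{H}$ and a normal bounded operator $N$ on $\mathcal{K}$ with $N\mathcal{H}\subseteq\mathcal{H}$ and $N|_{\mathcal{H}}=A$. An operator $A$ is quasinormal if $A(A^*A)=(A^*A)A$. The notation $T^{*\kappa}$ means $(T^* )^{\kappa}$. *)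

theory Defs
  imports "HOL-Analysis.Analysis"
begin

class complex_vector = real_vector +
  fixes scaleC :: "complex \<Rightarrow> 'a \<Rightarrow> 'a"  (infixr \<open>*\<^sub>C\<close> 75)
  assumes scaleC_add_right: "c *\<^sub>C (x + y) = c *\<^sub>C x + c *\<^sub>C y"
    and scaleC_add_left: "(c + d) *\<^sub>C x = c *\<^sub>C x + d *\<^sub>C x"
    and scaleC_scaleC: "c *\<^sub>C (d *\<^sub>C x) = (c * d) *\<^sub>C x"
    and scaleC_of_real: "complex_of_real r *\<^sub>C x = r *\<^sub>R x"

text \<open>The complex inner product is linear in its first argument. Since \<open>Re \<langle>x, y\<rangle>\<close> is the
  real inner product of the library class, \<open>\<langle>x, x\<rangle>\<close> equals \<open>\<parallel>x\<parallel>\<^sup>2\<close>: positive definiteness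
  and the link with the norm are inherited from \<^class>\<open>real_inner\<close>.\<close>

class complex_inner = complex_vector + real_inner +
  fixes cinner :: "'a \<Rightarrow> 'a \<Rightarrow> complex"
  assumes cinner_commute: "cinner x y = cnj (cinner y x)"
    and cinner_add_left: "cinner (x + y) z = cinner x z + cinner y z"
    and cinner_scaleC_left: "cinner (c *\<^sub>C x) y = c * cinner x y"
    and Re_cinner: "Re (cinner x y) = inner x y"

class chilbert_space = complex_inner + banach

definition csubspace :: "'a::complex_vector set \<Rightarrow> bool" where
  "csubspace M \<longleftrightarrow> 0 \<in> M \<and> (\<forall>x\<in>M. \<forall>y\<in>M. x + y \<in> M) \<and> (\<forall>c. \<forall>x\<in>M. c *\<^sub>C x \<in> M)"

definition bounded_clinear :: "('a::complex_inner \<Rightarrow> 'b::complex_inner) \<Rightarrow> bool" where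
  "bounded_clinear T \<longleftrightarrow> bounded_linear T \<and> (\<forall>c x. T (c *\<^sub>C x) = c *\<^sub>C T x)"

text \<open>For a bounded operator between Hilbert spaces such an \<open>S\<close> exists (Riesz) and is unique.\<close>

definition cadjoint :: "('a::chilbert_space \<Rightarrow> 'b::chilbert_space) \<Rightarrow> 'b \<Rightarrow> 'a" where
  "cadjoint T = (SOME S. \<forall>x y. cinner (T x) y = cinner x (S y))"

definition normal_op :: "('a::chilbert_space \<Rightarrow> 'a) \<Rightarrow> bool" where
  "normal_op N \<longleftrightarrow> bounded_clinear N \<and> cadjoint N \<circ> N = N \<circ> cadjoint N"

definition quasinormal_op :: "('a::chilbert_space \<Rightarrow> 'a) \<Rightarrow> bool" where
  "quasinormal_op A \<longleftrightarrow> bounded_clinear A \<and>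
    A \<circ> (cadjoint A \<circ> A) = (cadjoint A \<circ> A) \<circ> A"

definition unitary_onto :: "('a::chilbert_space \<Rightarrow> 'b::chilbert_space) \<Rightarrow> 'b set \<Rightarrow> bool" where
  "unitary_onto U M \<longleftrightarrow>
    bounded_clinear U \<and> (\<forall>x y. cinner (U x) (U y) = cinner x y) \<and> range U = M"

text \<open>\<open>A\<close> is unitarily equivalent to the restriction of a normal operator on the Hilbert space
  \<open>'k\<close> to a closed invariant subspace. HOL cannot quantify over types inside a formula, so \<open>'k\<close>
  is a parameter; \<open>A\<close> is subnormal iff this holds for some \<open>'k\<close>. In a premise with \<open>'k\<close> a free
  type variable, the universal quantification over \<open>'k\<close> amounts to that existential.\<close>

definition subnormal_op :: "'k::chilbert_space itself \<Rightarrow> ('h::chilbert_space \<Rightarrow> 'h) \<Rightarrow> bool" where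
  "subnormal_op (_ :: 'k itself) A \<longleftrightarrow> bounded_clinear A \<and>
    (\<exists>(N :: 'k \<Rightarrow> 'k) M U. normal_op N \<and> csubspace M \<and> closed M \<and> N ` M \<subseteq> M \<and>
      unitary_onto U M \<and> (\<forall>x. U (A x) = N (U x)))"

end

theory Submission
  imports Defs "HOL-Computational_Algebra.Fundamental_Theorem_Algebra"
begin

text \<open>Let \<open>N\<close> be the normal extension of \<open>A\<close> along the isometry \<open>U\<close>, and put \<open>D = N\<^sup>*N\<close>,
  \<open>B = D\<^sup>n\<close>, \<open>C = T\<^sup>*T\<close>. Since \<open>N\<close> is normal, \<open>T\<^sup>*\<^sup>jT\<^sup>j = U\<^sup>*B\<^sup>jU\<close>, so the hypothesis gives
  \<open>U\<^sup>*B\<^sup>kU \<le> C\<^sup>k\<close> for one \<open>k \<ge> 2\<close>. Positivity of a block operator roughly halves the exponent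
  for which this inequality holds, until \<open>k = 2\<close>, where it says that
  \<open>\<parallel>BUx\<parallel> \<le> \<parallel>U\<^sup>*BUx\<parallel>\<close>; hence \<open>BU = UC\<close>. Approximating the \<open>n\<close>-th root by polynomials, the range
  of \<open>U\<close> is invariant under \<open>D\<close> as well, so \<open>DU = UA\<^sup>*A\<close>, and \<open>A\<close> inherits
  from \<open>N\<close> that it commutes with \<open>A\<^sup>*A\<close>.\<close>

section \<open>Riesz representation and adjoints\<close>

text \<open>By the parallelogram identity \<open>par\<close>, the distance of two points is
  controlled by how far their values exceed \<open>m\<close>, since the value at their midpoint is
  at least \<open>m\<close>.\<close>

lemma minimizing_sequence_converges:
  fixes f :: "'a::{real_inner,banach} \<Rightarrow> real"
  assumes f: "bounded_linear f"
    and ge: "\<And>x. m \<le> (norm x)\<^sup>2 - 2 * f x"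
    and lim: "(\<lambda>n. (norm (X n))\<^sup>2 - 2 * f (X n)) \<longlonglongrightarrow> m"
  shows "convergent X"
proof -
  interpret f: bounded_linear f by fact
  define J where "J x = (norm x)\<^sup>2 - 2 * f x" for x
  have par: "(norm (x - y))\<^sup>2 = 2 * J x + 2 * J y - 4 * J ((1/2) *\<^sub>R (x + y))" for x y
    unfolding J_def power2_norm_eq_inner
    by (simp add: f.add f.scaleR inner_simps inner_commute[of y x] algebra_simps)
  have "Cauchy X"
  proof (rule metric_CauchyI)
    fix e :: real assume "e > 0"
    have "\<forall>\<^sub>F n in sequentially. J (X n) < m + e\<^sup>2 / 4"
      using order_tendstoD(2)[OF lim, of "m + e\<^sup>2/4"] \<open>e > 0\<close> by (simp add: J_def)
    then obtain N where N: "\<And>n. n \<ge> N \<Longrightarrow> J (X n) < m + e\<^sup>2 / 4"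
      by (auto simp: eventually_sequentially)
    have "dist (X i) (X j) < e" if "i \<ge> N" "j \<ge> N" for i j
    proof -
      have "m \<le> J ((1/2) *\<^sub>R (X i + X j))" using ge by (simp only: J_def)
      then have "(norm (X i - X j))\<^sup>2 < e\<^sup>2"
        using par[of "X i" "X j"] N[OF that(1)] N[OF that(2)] by linarith
      then show ?thesis
        using \<open>e > 0\<close> by (simp add: dist_norm power2_less_imp_less)
    qed
    then show "\<exists>M. \<forall>i\<ge>M. \<forall>n\<ge>M. dist (X i) (X n) < e" by blast
  qed
  then show ?thesis by (simp add: Cauchy_convergent_iff)
qed

text \<open>The representing vector is the minimiser of \<open>\<parallel>x\<parallel>\<^sup>2 - 2 f x\<close>.\<close>

lemma riesz_representation:
  fixes f :: "'a::{real_inner,banach} \<Rightarrow> real"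
  assumes f: "bounded_linear f"
  shows "\<exists>z. \<forall>x. f x = inner x z"
proof -
  interpret f: bounded_linear f by fact
  define J where "J x = (norm x)\<^sup>2 - 2 * f x" for x
  have lower: "- (onorm f)\<^sup>2 \<le> J x" for x
  proof -
    have "f x \<le> onorm f * norm x" using onorm[OF f, of x] by simp
    moreover have "0 \<le> (norm x - onorm f)\<^sup>2" by simp
    ultimately show ?thesis by (simp add: J_def power2_eq_square algebra_simps)
  qed
  define m where "m = Inf (range J)"
  have bdd: "bdd_below (range J)" using lower by (auto intro!: bdd_belowI)
  have ge: "m \<le> J x" for x unfolding m_def by (rule cInf_lower) (use bdd in auto)
  have "\<exists>x. J x < m + inverse (real (Suc n))" for n
  proof -
    have "Inf (range J) < m + inverse (real (Suc n))" by (simp add: m_def)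
    then show ?thesis using cInf_less_iff[OF _ bdd] by auto
  qed
  then obtain X where X: "\<And>n. J (X n) < m + inverse (real (Suc n))" by metis
  have up: "(\<lambda>n. m + inverse (real (Suc n))) \<longlonglongrightarrow> m"
    using tendsto_add[OF tendsto_const LIMSEQ_inverse_real_of_nat] by simp
  have lim: "(\<lambda>n. J (X n)) \<longlonglongrightarrow> m"
    by (rule tendsto_sandwich[OF _ _ tendsto_const up]) (use ge X in \<open>auto simp: less_imp_le\<close>)
  have "convergent X"
    using minimizing_sequence_converges[OF f] ge lim unfolding J_def by blast
  then obtain z where z: "X \<longlonglongrightarrow> z" by (auto simp: convergent_def)
  have "(\<lambda>n. J (X n)) \<longlonglongrightarrow> J z" unfolding J_def
    by (intro tendsto_intros z f.tendsto)
  then have Jz: "J z = m" using lim LIMSEQ_unique by blast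
  have "f x = inner x z" for x
  proof (cases "x = 0")
    case True then show ?thesis by simp
  next
    case False
    define d where "d = inner x z - f x"
    \<comment> \<open>This \<open>t\<close> minimises \<open>2 * t * d + t^2 * (norm x)^2\<close>;
      the minimum \<open>- d^2 / (norm x)^2\<close> is nonnegative only if
      \<open>d = 0\<close>.\<close>
    define t where "t = - d / (norm x)\<^sup>2"
    have "J (z + t *\<^sub>R x) = J z + 2 * t * d + t\<^sup>2 * (norm x)\<^sup>2"
      unfolding J_def d_def f.add f.scaleR power2_norm_eq_inner
      by (simp add: inner_simps power2_eq_square inner_commute[of z x] algebra_simps)
    then have "0 \<le> 2 * t * d + t\<^sup>2 * (norm x)\<^sup>2" using ge[of "z + t *\<^sub>R x"] Jz by simp
    also have "\<dots> = - d\<^sup>2 / (norm x)\<^sup>2"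
      using False by (simp add: t_def power2_eq_square field_simps)
    finally have "d\<^sup>2 \<le> 0" using False by (simp add: field_simps)
    then show ?thesis by (simp add: d_def)
  qed
  then show ?thesis by blast
qed

section \<open>The complex inner product and the norm\<close>

lemma cinner_add_right: "cinner x (y + z) = cinner x y + cinner (x::'a::complex_inner) z"
  by (metis cinner_add_left cinner_commute complex_cnj_add)

lemma cinner_scaleC_right: "cinner x (c *\<^sub>C y) = cnj c * cinner (x::'a::complex_inner) y"
  by (metis cinner_commute cinner_scaleC_left complex_cnj_mult)

lemma Im_cinner: "Im (cinner x y) = - inner (\<i> *\<^sub>C x) (y::'a::complex_inner)"
  by (simp add: cinner_scaleC_left flip: Re_cinner)

text \<open>Up to sign, the imaginary part is the real inner product at
  \<open>\<i> *\<^sub>C x\<close>, so complex identities reduce to real ones.\<close>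

lemma cinner_eqI:
  fixes x y z w :: "_::complex_inner"
  assumes "inner x y = inner z w" "inner (\<i> *\<^sub>C x) y = inner (\<i> *\<^sub>C z) w"
  shows "cinner x y = cinner z w"
  by (rule complex_eqI) (use assms in \<open>simp_all add: Re_cinner Im_cinner\<close>)

lemma cinner_self: "cinner x x = of_real ((norm (x::'a::complex_inner))\<^sup>2)"
proof (rule complex_eqI)
  show "Im (cinner x x) = Im (of_real ((norm x)\<^sup>2))"
    using arg_cong[OF cinner_commute[of x x], of Im] by simp
qed (simp add: Re_cinner power2_norm_eq_inner)

lemma norm_scaleC: "norm (c *\<^sub>C x) = cmod c * norm (x::'a::complex_inner)"
proof -
  have "of_real ((norm (c *\<^sub>C x))\<^sup>2) = cinner (c *\<^sub>C x) (c *\<^sub>C x)"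
    by (rule cinner_self[symmetric])
  also have "\<dots> = complex_of_real ((cmod c * norm x)\<^sup>2)"
    unfolding cinner_scaleC_left cinner_scaleC_right cinner_self[of x] power_mult_distrib
    by (simp add: complex_norm_square[of c] del: of_real_power)
  finally have "of_real ((norm (c *\<^sub>C x))\<^sup>2) = complex_of_real ((cmod c * norm x)\<^sup>2)" .
  then have "(norm (c *\<^sub>C x))\<^sup>2 = (cmod c * norm x)\<^sup>2" using of_real_eq_iff by blast
  then show ?thesis by (simp add: power2_eq_iff_nonneg)
qed

lemma cmod_cinner_le: "cmod (cinner x y) \<le> norm x * norm (y::'a::complex_inner)"
proof (cases "cinner x y = 0")
  case False
  define w where "w = cinner x y"
  \<comment> \<open>The unimodular \<open>c\<close> rotates \<open>cinner x y\<close> onto its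
    modulus, which leaves the real Cauchy-Schwarz inequality.\<close>
  define c where "c = cnj w / of_real (cmod w)"
  have w: "w \<noteq> 0" using False by (simp add: w_def)
  have "cinner (c *\<^sub>C x) y = of_real (cmod w)"
    using w complex_norm_square[of w]
    by (simp add: cinner_scaleC_left c_def w_def[symmetric] power2_eq_square field_simps)
  then have "cmod w = inner (c *\<^sub>C x) y" by (metis Re_cinner Re_complex_of_real)
  also have "\<dots> \<le> norm (c *\<^sub>C x) * norm y" by (rule norm_cauchy_schwarz)
  also have "norm (c *\<^sub>C x) = norm x" using w by (simp add: norm_scaleC c_def norm_divide)
  finally show ?thesis by (simp add: w_def)
qed simp

lemma cinner_ext:
  fixes x y :: "'a::complex_inner"
  assumes "\<And>z. cinner z x = cinner z y"
  shows "x = y"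
proof -
  have "inner (x - y) x = inner (x - y) y"
    using arg_cong[OF assms[of "x - y"], of Re] by (simp add: Re_cinner)
  then have "inner (x - y) (x - y) = 0" by (simp add: inner_diff_right)
  then show ?thesis by simp
qed

text \<open>Real Riesz representation yields an adjoint for \<open>inner\<close>; complex linearity
  of \<open>T\<close> makes it one for \<open>cinner\<close>. It is the witness that the
  \<open>SOME\<close> in the definition calls for.\<close>

lemma cadjoint:
  fixes T :: "'a::chilbert_space \<Rightarrow> 'b::chilbert_space"
  assumes T: "bounded_clinear T"
  shows "cinner (T x) y = cinner x (cadjoint T y)"
proof -
  have "\<exists>z. \<forall>x. inner (T x) y = inner x z" for y
  proof (rule riesz_representation)
    show "bounded_linear (\<lambda>x. inner (T x) y)"
      using T unfolding bounded_clinear_def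
      by (blast intro: bounded_linear_compose[OF bounded_linear_inner_left])
  qed
  then obtain S where S: "\<And>x y. inner (T x) y = inner x (S y)" by metis
  have "cinner (T x) y = cinner x (S y)" for x y
  proof (rule cinner_eqI)
    show "inner (\<i> *\<^sub>C T x) y = inner (\<i> *\<^sub>C x) (S y)"
      using S[of "\<i> *\<^sub>C x" y] T by (simp add: bounded_clinear_def)
  qed (rule S)
  then have "\<exists>S. \<forall>x y. cinner (T x) y = cinner x (S y)" by blast
  from someI_ex[OF this] show ?thesis unfolding cadjoint_def by blast
qed

lemma inner_cadjoint:
  fixes T :: "'a::chilbert_space \<Rightarrow> 'b::chilbert_space"
  assumes "bounded_clinear T"
  shows "inner (T x) y = inner x (cadjoint T y)"
  using cadjoint[OF assms, of x y] by (metis Re_cinner)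

lemma bounded_clinear_cadjoint:
  fixes T :: "'a::chilbert_space \<Rightarrow> 'b::chilbert_space"
  assumes T: "bounded_clinear T"
  shows "bounded_clinear (cadjoint T)"
proof -
  note adj = cadjoint[OF T, symmetric]
  have bl: "bounded_linear T" using T by (simp add: bounded_clinear_def)
  have add: "cadjoint T (x + y) = cadjoint T x + cadjoint T y" for x y
    by (rule cinner_ext) (simp add: adj cinner_add_right)
  have sc: "cadjoint T (c *\<^sub>C x) = c *\<^sub>C cadjoint T x" for c x
    by (rule cinner_ext) (simp add: adj cinner_scaleC_right)
  have "norm (cadjoint T y) \<le> norm y * onorm T" for y
  proof (cases "cadjoint T y = 0")
    case True then show ?thesis using onorm_pos_le[OF bl] by simp
  next
    case False
    have "norm (cadjoint T y) * norm (cadjoint T y) = inner (T (cadjoint T y)) y"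
      by (simp add: inner_cadjoint[OF T] power2_norm_eq_inner flip: power2_eq_square)
    also have "\<dots> \<le> norm (T (cadjoint T y)) * norm y" by (rule norm_cauchy_schwarz)
    also have "\<dots> \<le> (onorm T * norm (cadjoint T y)) * norm y"
      by (intro mult_right_mono onorm[OF bl]) simp
    finally show ?thesis using False by (simp add: mult_ac)
  qed
  then have "bounded_linear (cadjoint T)"
    by (intro bounded_linear_intro[of _ "onorm T"] add)
      (simp_all add: sc flip: scaleC_of_real)
  then show ?thesis using sc by (simp add: bounded_clinear_def)
qed

section \<open>Compositions and powers of operators\<close>

lemma bounded_clinear_compose:
  assumes "bounded_clinear f" "bounded_clinear g"
  shows "bounded_clinear (f \<circ> g)"
  using assms bounded_linear_compose[of f g] by (auto simp: bounded_clinear_def o_def)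

lemma bounded_linear_funpow:
  fixes f :: "'a::real_normed_vector \<Rightarrow> 'a"
  assumes "bounded_linear f"
  shows "bounded_linear (f ^^ k)"
proof (induction k)
  case (Suc k)
  then show ?case using bounded_linear_compose[OF assms Suc] by (simp add: o_def)
qed (simp add: id_def)

lemma bounded_clinear_funpow:
  fixes f :: "'a::complex_inner \<Rightarrow> 'a"
  shows "bounded_clinear f \<Longrightarrow> bounded_clinear (f ^^ k)"
proof (induction k)
  case (Suc k)
  then show ?case using bounded_clinear_compose[of f "f ^^ k"] by (simp add: comp_def)
qed (auto simp: bounded_clinear_def id_def)

lemma funpow_intertwine: "(\<And>x. U (f x) = g (U x)) \<Longrightarrow> U ((f ^^ k) x) = (g ^^ k) (U x)"
  by (induction k) auto

lemma inner_funpow_adjoint: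
  fixes f g :: "'a::real_inner \<Rightarrow> 'a"
  assumes "\<And>x y. inner (f x) y = inner x (g y)"
  shows "inner ((f ^^ k) x) y = inner x ((g ^^ k) y)"
  by (induction k arbitrary: y) (auto simp: assms funpow_swap1[of g])

lemma funpow_comp_commute:
  assumes "f \<circ> g = g \<circ> f"
  shows "(f ^^ k) \<circ> (g ^^ k) = (f \<circ> g) ^^ k"
proof (induction k)
  case (Suc k)
  have *: "(f ^^ k) (g x) = g ((f ^^ k) x)" for x
    using funpow_intertwine[of g f f] fun_cong[OF assms] by simp
  have IH: "(f ^^ k) ((g ^^ k) x) = ((f \<circ> g) ^^ k) x" for x
    using fun_cong[OF Suc, of x] by (simp add: comp_def)
  have "(f ^^ Suc k) ((g ^^ Suc k) x) = ((f \<circ> g) ^^ Suc k) x" for x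
    by (simp only: funpow.simps o_apply * IH)
  then show ?case by (intro ext) (rule trans[OF o_apply])
qed simp

section \<open>Comparison of quadratic forms\<close>

text \<open>Half of the factors move across the inner product: an even power leaves a squared norm,
  an odd one the form of \<open>Y\<close> at \<open>(Y ^^ j) x\<close>.\<close>

lemma power_positive:
  fixes Y :: "'a::real_inner \<Rightarrow> 'a"
  assumes sym: "\<And>x y. inner (Y x) y = inner x (Y y)" and pos: "\<And>x. 0 \<le> inner (Y x) x"
  shows "0 \<le> inner ((Y ^^ k) x) x"
proof -
  note s = inner_funpow_adjoint[where f=Y and g=Y, OF sym]
  consider j where "k = j + j" | j where "k = j + Suc j"
    by (metis Suc_eq_plus1 add_Suc_right evenE mult_2 oddE)
  then show ?thesis
  proof cases
    case 1
    then have "inner ((Y ^^ k) x) x = inner ((Y ^^ j) x) ((Y ^^ j) x)"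
      by (simp only: funpow_add o_apply s)
    then show ?thesis by simp
  next
    case 2
    then have "inner ((Y ^^ k) x) x = inner (Y ((Y ^^ j) x)) ((Y ^^ j) x)"
      by (simp only: funpow_add o_apply s funpow.simps)
    then show ?thesis using pos by simp
  qed
qed

text \<open>Positivity is tested at \<open>x - t *\<^sub>R S x\<close> with \<open>t\<close> the
  inverse of the operator norm. The bound turns a small quadratic form into a small image
  vector.\<close>

lemma positive_norm_le:
  fixes S :: "'a::real_inner \<Rightarrow> 'a"
  assumes S: "bounded_linear S" and sym: "\<And>x y. inner (S x) y = inner x (S y)"
    and pos: "\<And>x. 0 \<le> inner (S x) x"
  shows "(norm (S x))\<^sup>2 \<le> onorm S * inner (S x) x"
proof (cases "onorm S = 0")
  case True
  then have "S x = 0" using onorm[OF S, of x] by simp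
  then show ?thesis by simp
next
  case False
  interpret S: bounded_linear S by fact
  have K: "onorm S > 0" using False onorm_pos_le[OF S] by simp
  define t where "t = inverse (onorm S)"
  have "inner (S (S x)) (S x) \<le> norm (S (S x)) * norm (S x)" by (rule norm_cauchy_schwarz)
  also have "\<dots> \<le> onorm S * norm (S x) * norm (S x)"
    by (intro mult_right_mono onorm[OF S]) simp
  finally have *: "inner (S (S x)) (S x) \<le> onorm S * (norm (S x))\<^sup>2"
    by (simp add: power2_eq_square mult_ac)
  have "0 \<le> inner (S (x - t *\<^sub>R S x)) (x - t *\<^sub>R S x)" by (rule pos)
  also have "\<dots> = inner (S x) x - 2 * t * (norm (S x))\<^sup>2 + t\<^sup>2 * inner (S (S x)) (S x)"
    unfolding power2_norm_eq_inner
    by (simp add: S.diff S.scaleR inner_simps sym[of "S x" x] power2_eq_square algebra_simps)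
  also have "\<dots> \<le> inner (S x) x - 2 * t * (norm (S x))\<^sup>2 + t\<^sup>2 * (onorm S * (norm (S x))\<^sup>2)"
    using * by (simp add: mult_left_mono)
  also have "\<dots> = inner (S x) x - t * (norm (S x))\<^sup>2"
    using K by (simp add: t_def power2_eq_square)
  finally show ?thesis using K by (simp add: t_def field_simps)
qed

text \<open>Here \<open>l\<close> is the supremum of the form on the unit sphere. Then
  \<open>R = l - S\<close> is positive, and \<open>positive_norm_le\<close> for \<open>R\<close>
  makes unit vectors with nearly maximal form approximate eigenvectors.\<close>

lemma approximate_top_eigenvector:
  fixes S :: "'a::real_inner \<Rightarrow> 'a"
  assumes S: "bounded_linear S" and sym: "\<And>x y. inner (S x) y = inner x (S y)"
    and x: "inner (S x) x > 0"
  obtains l where "l > 0" and "\<And>e. e > 0 \<Longrightarrow> \<exists>z. norm z = 1 \<and> norm (S z - l *\<^sub>R z) < e"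
proof -
  interpret S: bounded_linear S by fact
  define V where "V = (\<lambda>z. inner (S z) z) ` {z. norm z = 1}"
  define l where "l = Sup V"
  have bd: "inner (S z) z \<le> onorm S" if "norm z = 1" for z
    using norm_cauchy_schwarz[of "S z" z] onorm[OF S, of z] that by simp
  have bdd: "bdd_above V" unfolding V_def using bd by (auto intro!: bdd_aboveI)
  have x0: "x \<noteq> 0" using x by auto
  have nrm: "inner (S z) z = (norm z)\<^sup>2 * inner (S (sgn z)) (sgn z)" for z
    by (cases "z = 0") (simp_all add: sgn_div_norm S.scaleR power2_eq_square field_simps)
  have le: "inner (S z) z \<le> l * (norm z)\<^sup>2" for z
  proof (cases "z = 0")
    case False
    have "inner (S (sgn z)) (sgn z) \<le> l"
      unfolding l_def by (rule cSup_upper[OF _ bdd]) (use False in \<open>auto simp: V_def norm_sgn\<close>)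
    then show ?thesis by (subst nrm) (simp add: mult.commute mult_right_mono)
  qed (simp add: S.zero)
  have l0: "l > 0"
  proof -
    have "0 < l * (norm x)\<^sup>2" using x le[of x] by linarith
    then show ?thesis using x0 by (simp add: zero_less_mult_iff)
  qed
  define R where "R z = l *\<^sub>R z - S z" for z
  have R: "bounded_linear R" unfolding R_def
    by (intro bounded_linear_sub bounded_linear_scaleR_right S)
  have Rsym: "inner (R x) y = inner x (R y)" for x y
    by (simp add: R_def inner_simps sym)
  have Rpos: "0 \<le> inner (R x) x" for x
    using le[of x] by (simp add: R_def inner_simps power2_norm_eq_inner)
  have "\<exists>z. norm z = 1 \<and> norm (S z - l *\<^sub>R z) < e" if e: "e > 0" for e
  proof -
    \<comment> \<open>The summand 1 keeps the denominator positive even if \<open>R\<close> is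
      zero.\<close>
    define q where "q = e\<^sup>2 / (onorm R + 1)"
    have K: "onorm R + 1 > 0" using onorm_pos_le[OF R] by simp
    then have q: "q > 0" using e by (simp add: q_def)
    have "\<exists>v\<in>V. l - q < v"
      using less_cSup_iff[OF _ bdd, of "l - q"] q x0 norm_sgn[of x] unfolding l_def V_def
      by auto
    then obtain z where z: "norm z = 1" "l - q < inner (S z) z" by (auto simp: V_def)
    have "inner (R z) z < q"
      using z by (simp add: R_def inner_simps dot_square_norm)
    then have "(onorm R + 1) * inner (R z) z < e\<^sup>2"
      using K by (simp add: q_def field_simps)
    moreover have "(norm (R z))\<^sup>2 \<le> onorm R * inner (R z) z"
      by (rule positive_norm_le[OF R Rsym Rpos])
    ultimately have "(norm (R z))\<^sup>2 < e\<^sup>2" using Rpos[of z] by (simp add: algebra_simps)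
    then have "norm (R z) < e" using e by (simp add: power2_less_imp_less)
    then show ?thesis using z by (auto simp: R_def norm_minus_commute)
  qed
  then show ?thesis using that l0 by blast
qed

text \<open>The hypothesis says that the block operator with rows \<open>(Y\<^sup>e, G)\<close> and \<open>(G, Y\<^sup>2\<^sup>m\<^sup>+\<^sup>e)\<close> is
  positive; the conclusion is that \<open>G\<close> is below the geometric mean of the diagonal. It is
  tested at \<open>u = Y\<^sup>m z + s z\<close> with \<open>z\<close> an approximate eigenvector of \<open>G - Y\<^sup>m\<^sup>+\<^sup>e\<close>.\<close>

lemma block_positive_le_power:
  fixes Y G :: "'a::real_inner \<Rightarrow> 'a"
  assumes Y: "bounded_linear Y" and Ysym: "\<And>x y. inner (Y x) y = inner x (Y y)"
    and Ypos: "\<And>x. 0 \<le> inner (Y x) x"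
    and G: "bounded_linear G" and Gsym: "\<And>x y. inner (G x) y = inner x (G y)"
    and block: "\<And>u z. 0 \<le> inner ((Y ^^ e) u) u - 2 * inner (G z) u + inner ((Y ^^ (2 * m + e)) z) z"
  shows "inner (G x) x \<le> inner ((Y ^^ (m + e)) x) x"
proof (rule ccontr)
  assume neg: "\<not> ?thesis"
  have Yk: "bounded_linear (Y ^^ k)" for k by (rule bounded_linear_funpow[OF Y])
  have s: "inner ((Y ^^ k) x) y = inner x ((Y ^^ k) y)" for k x y
    by (rule inner_funpow_adjoint[OF Ysym])
  define S where "S x = G x - (Y ^^ (m + e)) x" for x
  have "bounded_linear S" unfolding S_def by (intro bounded_linear_sub G Yk)
  moreover have "inner (S x) y = inner x (S y)" for x y
    by (simp add: S_def inner_simps Gsym s)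
  moreover have "inner (S x) x > 0" using neg by (simp add: S_def inner_simps)
  ultimately obtain l where l: "l > 0"
    and ap: "\<And>e. e > 0 \<Longrightarrow> \<exists>z. norm z = 1 \<and> norm (S z - l *\<^sub>R z) < e"
    using approximate_top_eigenvector by blast
  define M where "M = onorm (Y ^^ e) + 1"
  define L where "L = onorm (Y ^^ m)"
  have M: "M > 0" using onorm_pos_le[OF Yk[of e]] by (simp add: M_def)
  have L: "L \<ge> 0" using onorm_pos_le[OF Yk[of m]] by (simp add: L_def)
  \<comment> \<open>With this \<open>r\<close> the term \<open>r^2 * inner ((Y ^^ e) z) z\<close>
    costs at most \<open>l * r\<close>, half of the gain \<open>2 * l * r\<close> from the
    eigenvalue; \<open>\<epsilon>\<close> is chosen so that the error vector \<open>d\<close> costs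
    less than the other half.\<close>
  define r where "r = l / M"
  have r: "r > 0" using l M by (simp add: r_def)
  define \<epsilon> where "\<epsilon> = l * r / (2 * (L + r))"
  have "\<epsilon> > 0" using l r L by (simp add: \<epsilon>_def)
  then obtain z where z: "norm z = 1" "norm (S z - l *\<^sub>R z) < \<epsilon>" using ap by blast
  define d where "d = S z - l *\<^sub>R z"
  define u where "u = (Y ^^ m) z + r *\<^sub>R z"
  interpret Ye: bounded_linear "Y ^^ e" by (rule Yk)
  have zz: "inner z z = 1" using z(1) by (simp add: dot_square_norm)
  have YY: "(Y ^^ a) ((Y ^^ b) x) = (Y ^^ (a + b)) x" for a b x
    by (simp add: funpow_add)
  have move: "inner ((Y ^^ a) x) ((Y ^^ b) y) = inner ((Y ^^ (b + a)) x) y" for a b x y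
    by (simp only: s[symmetric] YY)
  have p1: "inner ((Y ^^ e) ((Y ^^ m) z)) ((Y ^^ m) z) = inner ((Y ^^ (2 * m + e)) z) z"
    unfolding YY move by (simp add: mult_2 add_ac)
  have p2: "inner ((Y ^^ e) ((Y ^^ m) z)) z = inner ((Y ^^ (m + e)) z) z"
    unfolding YY by (simp add: add.commute)
  have p3: "inner ((Y ^^ e) z) ((Y ^^ m) z) = inner ((Y ^^ (m + e)) z) z"
    unfolding move ..
  have p4: "inner ((Y ^^ (m + e)) z) ((Y ^^ m) z) = inner ((Y ^^ (2 * m + e)) z) z"
    unfolding move by (simp add: mult_2 add_ac)
  have e1: "inner ((Y ^^ e) u) u = inner ((Y ^^ (2 * m + e)) z) z
      + 2 * r * inner ((Y ^^ (m + e)) z) z + r\<^sup>2 * inner ((Y ^^ e) z) z"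
    by (simp add: u_def Ye.add Ye.scaleR inner_simps p1 p2 p3 power2_eq_square algebra_simps)
  have Gz: "G z = (Y ^^ (m + e)) z + l *\<^sub>R z + d" by (simp add: d_def S_def)
  have "inner (G z) u = inner ((Y ^^ (m + e)) z) ((Y ^^ m) z + r *\<^sub>R z)
      + l * inner z ((Y ^^ m) z + r *\<^sub>R z) + inner d u"
    unfolding Gz inner_add_left inner_scaleR_left u_def ..
  also have "\<dots> = inner ((Y ^^ (2 * m + e)) z) z + r * inner ((Y ^^ (m + e)) z) z
      + (l * inner ((Y ^^ m) z) z + l * r) + inner d u"
    unfolding inner_add_right inner_scaleR_right p4 zz inner_commute[of z "(Y ^^ m) z"]
    by (simp only: distrib_left mult_1_right)
  finally have e2: "inner (G z) u = inner ((Y ^^ (2 * m + e)) z) z + r * inner ((Y ^^ (m + e)) z) z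
      + l * inner ((Y ^^ m) z) z + l * r + inner d u"
    by linarith
  have "inner ((Y ^^ e) z) z \<le> M"
    using norm_cauchy_schwarz[of "(Y ^^ e) z" z] onorm[OF Yk, of e z] z(1) by (simp add: M_def)
  then have "r\<^sup>2 * inner ((Y ^^ e) z) z \<le> r\<^sup>2 * M" by (rule mult_left_mono) simp
  also have "r\<^sup>2 * M = l * r" using M by (simp add: r_def power2_eq_square)
  finally have t1: "r\<^sup>2 * inner ((Y ^^ e) z) z \<le> l * r" .
  have "norm u \<le> norm ((Y ^^ m) z) + norm (r *\<^sub>R z)" unfolding u_def by (rule norm_triangle_ineq)
  also have "norm ((Y ^^ m) z) \<le> L" using onorm[OF Yk, of m z] z(1) by (simp add: L_def)
  finally have u: "norm u \<le> L + r" using z(1) r by simp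
  have "norm d * norm u \<le> norm d * (L + r)" using u by (rule mult_left_mono) simp
  also have "\<dots> < \<epsilon> * (L + r)" using z(2) L r by (simp add: d_def)
  also have "\<dots> = l * r / 2"
  proof -
    have "L + r \<noteq> 0" using L r by linarith
    then show ?thesis unfolding \<epsilon>_def by (simp add: divide_simps del: distrib_left_numeral)
  qed
  finally have "norm d * norm u < l * r / 2" .
  then have t2: "- (2 * inner d u) < l * r"
    using Cauchy_Schwarz_ineq2[of d u] by linarith
  have t3: "0 \<le> l * inner ((Y ^^ m) z) z" using l power_positive[OF Ysym Ypos] by simp
  \<comment> \<open>The terms with exponents \<open>2 * m + e\<close> and \<open>m + e\<close>
    cancel, and the rest is below \<open>l * r - 2 * l * r + l * r = 0\<close>.\<close>
  show False using block[of u z] t1 t2 t3 unfolding e1 e2 by simp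
qed

text \<open>\<open>Y\<close> is the compression of \<open>B\<close> along \<open>U\<close>, and
  \<open>G j\<close> that of \<open>B ^^ j\<close>, which in general differs from
  \<open>Y ^^ j\<close>. The induction halves \<open>k\<close>, rounding up, until
  \<open>k = 2\<close>, where the inequality makes the norm of \<open>B (U x) - U (Y x)\<close>
  vanish.\<close>

lemma intertwine_of_power_le:
  fixes Y :: "'a::real_inner \<Rightarrow> 'a" and B :: "'b::real_inner \<Rightarrow> 'b" and U :: "'a \<Rightarrow> 'b"
  assumes Y: "bounded_linear Y"
    and B: "bounded_linear B" and Bsym: "\<And>x y. inner (B x) y = inner x (B y)"
    and Bpos: "\<And>x. 0 \<le> inner (B x) x"
    and U: "bounded_linear U" and iso: "\<And>x y. inner (U x) (U y) = inner x y"
    and YB: "\<And>x y. inner (Y x) y = inner (B (U x)) (U y)"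
    and G: "\<And>j. bounded_linear (G j)"
    and GB: "\<And>j x y. inner (G j x) y = inner ((B ^^ j) (U x)) (U y)"
    and "2 \<le> k" and "\<And>x. inner ((B ^^ k) (U x)) (U x) \<le> inner ((Y ^^ k) x) x"
  shows "B (U x) = U (Y x)"
  using assms(10-11)
proof (induction k rule: less_induct)
  case (less k)
  interpret U: bounded_linear U by (rule U)
  have Bs: "inner ((B ^^ j) x) y = inner x ((B ^^ j) y)" for j x y
    by (rule inner_funpow_adjoint[OF Bsym])
  have Ysym: "inner (Y x) y = inner x (Y y)" for x y
    by (metis YB Bsym inner_commute)
  have Ypos: "0 \<le> inner (Y x) x" for x by (simp add: YB Bpos)
  have Gsym: "inner (G j x) y = inner x (G j y)" for j x y
    by (metis GB Bs inner_commute)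
  show ?case
  proof (cases "k = 2")
    case True
    have "(norm (B (U x) - U (Y x)))\<^sup>2
        = inner (B (U x)) (B (U x)) - 2 * inner (B (U x)) (U (Y x)) + inner (U (Y x)) (U (Y x))"
      by (simp add: power2_norm_eq_inner inner_simps inner_commute)
    also have "\<dots> = inner ((B ^^ k) (U x)) (U x) - inner ((Y ^^ k) x) x"
    proof -
      have "inner ((B ^^ k) (U x)) (U x) = inner (B (U x)) (B (U x))"
        using Bsym[of "B (U x)" "U x"] by (simp add: True numeral_2_eq_2)
      moreover have "inner ((Y ^^ k) x) x = inner (Y x) (Y x)"
        using Ysym[of "Y x" x] by (simp add: True numeral_2_eq_2)
      ultimately show ?thesis by (simp add: iso flip: YB)
    qed
    also have "\<dots> \<le> 0" using less.prems(2) by simp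
    finally show ?thesis by simp
  next
    case False
    \<comment> \<open>\<open>m + e\<close> is half of \<open>k\<close> rounded up. For
      \<open>k\<close> at least 3 it is at least 2 and below \<open>k\<close>, so the descent ends
      exactly at 2.\<close>
    define m where "m = k div 2"
    define e where "e = k mod 2"
    have k: "k = 2 * m + e" by (simp add: m_def e_def)
    have j: "2 \<le> m + e" "m + e < k" using False less.prems(1) unfolding m_def e_def by presburger+
    interpret Be: bounded_linear "B ^^ e" by (rule bounded_linear_funpow[OF B])
    have BB: "(B ^^ a) ((B ^^ b) x) = (B ^^ (a + b)) x" for a b x by (simp add: funpow_add)
    have "e = 0 \<or> e = 1" by (auto simp: e_def)
    \<comment> \<open>For exponents 0 and 1 compression commutes with taking powers: 0 is the
      isometry, 1 is \<open>YB\<close>.\<close>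
    then have Ye: "inner ((Y ^^ e) u) u = inner ((B ^^ e) (U u)) (U u)" for u
      using iso YB by auto
    have "0 \<le> inner ((Y ^^ e) u) u - 2 * inner (G (m + e) z) u + inner ((Y ^^ (2 * m + e)) z) z"
      for u z
    proof -
      have c1: "inner ((B ^^ e) ((B ^^ m) (U z))) (U u) = inner (G (m + e) z) u"
        by (simp add: GB BB add.commute)
      have c2: "inner ((B ^^ e) (U u)) ((B ^^ m) (U z)) = inner (G (m + e) z) u"
        unfolding c1[symmetric] by (subst Bs) (rule inner_commute)
      have c3: "inner ((B ^^ e) ((B ^^ m) (U z))) ((B ^^ m) (U z)) = inner ((B ^^ k) (U z)) (U z)"
        unfolding Bs[of m _ "U z", symmetric] BB by (simp add: Bs[symmetric] BB k mult_2 add_ac)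
      \<comment> \<open>Expanding gives the block form with corner \<open>B ^^ k\<close>, which the
        hypothesis bounds by \<open>Y ^^ k\<close>.\<close>
      have "0 \<le> inner ((B ^^ e) (U u - (B ^^ m) (U z))) (U u - (B ^^ m) (U z))"
        by (rule power_positive[OF Bsym Bpos])
      also have "\<dots> = inner ((B ^^ e) (U u)) (U u) - 2 * inner (G (m + e) z) u
          + inner ((B ^^ k) (U z)) (U z)"
        unfolding Be.diff inner_diff_left inner_diff_right c1 c2 c3 by simp
      also have "\<dots> \<le> inner ((Y ^^ e) u) u - 2 * inner (G (m + e) z) u + inner ((Y ^^ k) z) z"
        using less.prems(2)[of z] by (simp add: Ye)
      finally show ?thesis by (simp only: k)
    qed
    then have "inner (G (m + e) x) x \<le> inner ((Y ^^ (m + e)) x) x" for x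
      by (rule block_positive_le_power[OF Y Ysym Ypos G Gsym])
    then show ?thesis using less.IH[OF j(2) j(1)] by (simp add: GB)
  qed
qed

section \<open>Polynomials of a positive operator\<close>

lemma scaleC_zero_left: "0 *\<^sub>C x = (0::'a::complex_vector)"
  using scaleC_of_real[of 0 x] by simp

lemma scaleC_one: "1 *\<^sub>C x = (x::'a::complex_vector)"
  using scaleC_of_real[of 1 x] by simp

lemma scaleC_minus_left: "(- c) *\<^sub>C x = - (c *\<^sub>C (x::'a::complex_vector))"
  using scaleC_add_left[of c "- c" x] by (simp add: scaleC_zero_left eq_neg_iff_add_eq_0 add.commute)

lemma scaleC_sum_right: "c *\<^sub>C (\<Sum>i\<in>I. f i) = (\<Sum>i\<in>I. c *\<^sub>C (f i::'a::complex_vector))"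
proof (induction I rule: infinite_finite_induct)
  have "c *\<^sub>C (0::'a) = 0" using scaleC_add_right[of c 0 "0::'a"] by simp
  then show "c *\<^sub>C (\<Sum>i\<in>I. f i) = (\<Sum>i\<in>I. c *\<^sub>C (f i::'a))" if "infinite I" for I
    using that by simp
  show "c *\<^sub>C (\<Sum>i\<in>{}. f i) = (\<Sum>i\<in>{}. c *\<^sub>C (f i::'a))" using \<open>c *\<^sub>C (0::'a) = 0\<close> by simp
qed (simp add: scaleC_add_right)

text \<open>Complex coefficients let \<open>p\<close> be split into linear factors.\<close>

definition poly_op :: "('a::complex_vector \<Rightarrow> 'a) \<Rightarrow> complex poly \<Rightarrow> 'a \<Rightarrow> 'a" where
  "poly_op D p x = (\<Sum>i\<le>degree p. coeff p i *\<^sub>C (D ^^ i) x)"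

lemma poly_op_eq_sum:
  assumes "degree p \<le> m"
  shows "poly_op D p x = (\<Sum>i\<le>m. coeff p i *\<^sub>C (D ^^ i) x)"
  unfolding poly_op_def
  by (rule sum.mono_neutral_left) (use assms in \<open>auto simp: coeff_eq_0 scaleC_zero_left\<close>)

lemma poly_op_add: "poly_op D (p + q) x = poly_op D p x + poly_op D q x"
proof -
  define m where "m = max (degree p) (degree q)"
  have "degree (p + q) \<le> m" "degree p \<le> m" "degree q \<le> m"
    by (auto simp: m_def degree_add_le)
  then show ?thesis by (simp add: poly_op_eq_sum[where m=m] scaleC_add_left sum.distrib)
qed

lemma poly_op_smult: "poly_op D (smult c p) x = c *\<^sub>C poly_op D p x"
  unfolding poly_op_eq_sum[OF degree_smult_le[of c p]]
  by (simp add: poly_op_def scaleC_sum_right scaleC_scaleC)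

lemma poly_op_monom: "poly_op D (monom c k) x = c *\<^sub>C (D ^^ k) x"
proof -
  have "poly_op D (monom c k) x = (\<Sum>i\<le>k. coeff (monom c k) i *\<^sub>C (D ^^ i) x)"
    by (rule poly_op_eq_sum) (rule degree_monom_le)
  also have "\<dots> = (\<Sum>i\<in>{k}. coeff (monom c k) i *\<^sub>C (D ^^ i) x)"
    by (rule sum.mono_neutral_right) (auto simp: scaleC_zero_left)
  finally show ?thesis by simp
qed

lemma poly_op_sum: "poly_op D (\<Sum>i\<in>I. p i) x = (\<Sum>i\<in>I. poly_op D (p i) x)"
  by (induction I rule: infinite_finite_induct)
    (auto simp: poly_op_add, auto simp: poly_op_def scaleC_zero_left)

text \<open>Multiplicativity in the form used when one root is split off in an induction on the
  degree.\<close>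

lemma poly_op_linear_mult:
  fixes D :: "'a::complex_vector \<Rightarrow> 'a"
  assumes add: "\<And>x y. D (x + y) = D x + D y" and sc: "\<And>c x. D (c *\<^sub>C x) = c *\<^sub>C D x"
  shows "poly_op D ([:- w, 1:] * q) x = D (poly_op D q x) - w *\<^sub>C poly_op D q x"
proof -
  have D0: "D 0 = 0" using sc[of 0 0] by (simp add: scaleC_zero_left)
  have Dsum: "D (\<Sum>i\<in>I. f i) = (\<Sum>i\<in>I. D (f i))" for I :: "nat set" and f
    by (induction I rule: infinite_finite_induct) (auto simp: add D0)
  have "poly_op D (pCons 0 q) x = (\<Sum>i\<le>Suc (degree q). coeff (pCons 0 q) i *\<^sub>C (D ^^ i) x)"
    by (rule poly_op_eq_sum) (rule degree_pCons_le)
  also have "\<dots> = D (poly_op D q x)"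
    unfolding sum.atMost_Suc_shift by (simp add: poly_op_def Dsum sc scaleC_zero_left)
  finally have "poly_op D (pCons 0 q) x = D (poly_op D q x)" .
  moreover have "[:- w, 1:] * q = smult (- w) q + pCons 0 q" by simp
  ultimately show ?thesis
    by (simp only: poly_op_add poly_op_smult scaleC_minus_left) simp
qed

text \<open>The Rayleigh quotient \<open>t x\<close> lies in \<open>{0..onorm D}\<close>, and
  pairing \<open>D x - w *\<^sub>C x\<close> with \<open>x\<close> gives
  \<open>(t x - w) * (norm x)^2\<close>. So a positive lower bound for the distance of
  \<open>w\<close> from the interval serves as \<open>c\<close>.\<close>

lemma positive_shift_bounded_below:
  fixes D :: "'a::complex_inner \<Rightarrow> 'a"
  assumes D: "bounded_clinear D" and sym: "\<And>x y. cinner (D x) y = cinner x (D y)"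
    and pos: "\<And>x. 0 \<le> inner (D x) x"
    and w: "w \<notin> complex_of_real ` {0..onorm D}"
  shows "\<exists>c>0. \<forall>x. c * norm x \<le> norm (D x - w *\<^sub>C x)"
proof -
  have bl: "bounded_linear D" using D by (simp add: bounded_clinear_def)
  define t where "t x = inner (D x) x / (norm x)\<^sup>2" for x
  obtain c where c: "c > 0" "\<And>s. s \<in> {0..onorm D} \<Longrightarrow> c \<le> cmod (of_real s - w)"
  proof -
    have "closed (complex_of_real ` {0..onorm D})"
      by (intro compact_imp_closed compact_continuous_image continuous_intros) simp
    from separate_point_closed[OF this w]
    obtain c where c: "0 < c" "\<And>y. y \<in> complex_of_real ` {0..onorm D} \<Longrightarrow> c \<le> dist w y"
      by metis
    show ?thesis
    proof
      show "c \<le> cmod (of_real s - w)" if "s \<in> {0..onorm D}" for s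
        using c(2)[OF imageI[OF that]] by (simp add: dist_norm norm_minus_commute)
    qed (rule c(1))
  qed
  have "c * norm x \<le> norm (D x - w *\<^sub>C x)" for x
  proof (cases "x = 0")
    case False
    then have n: "norm x > 0" by simp
    have "inner (D x) x \<le> norm (D x) * norm x" by (rule norm_cauchy_schwarz)
    also have "\<dots> \<le> onorm D * norm x * norm x" by (intro mult_right_mono onorm[OF bl]) simp
    finally have t: "t x \<in> {0..onorm D}"
      using n pos[of x] by (simp add: t_def field_simps power2_eq_square)
    have "Im (cinner (D x) x) = 0"
      using arg_cong[OF cinner_commute[of "D x" x], of Im] sym[of x x] by simp
    then have Dx: "cinner (D x) x = of_real (t x * (norm x)\<^sup>2)"
      using n by (intro complex_eqI) (simp_all add: Re_cinner t_def)
    have "cinner (D x - w *\<^sub>C x) x = cinner (D x + (- w) *\<^sub>C x) x"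
      by (simp add: scaleC_minus_left)
    also have "\<dots> = (of_real (t x) - w) * of_real ((norm x)\<^sup>2)"
      unfolding cinner_add_left cinner_scaleC_left Dx cinner_self by (simp add: algebra_simps)
    finally have "cmod (cinner (D x - w *\<^sub>C x) x) = cmod (of_real (t x) - w) * (norm x)\<^sup>2"
      by (simp add: norm_mult norm_power)
    then have "c * (norm x)\<^sup>2 \<le> cmod (cinner (D x - w *\<^sub>C x) x)"
      using c(2)[OF t] mult_right_mono[of c _ "(norm x)\<^sup>2"] by simp
    also have "\<dots> \<le> norm (D x - w *\<^sub>C x) * norm x" by (rule cmod_cinner_le)
    finally show ?thesis using n by (simp add: power2_eq_square)
  qed simp
  then show ?thesis using c(1) by blast
qed

text \<open>A root \<open>w\<close> of \<open>p\<close> lies off the interval, so its linear factor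
  is bounded below; the lower bounds of the factors multiply.\<close>

lemma poly_op_bounded_below:
  fixes D :: "'a::complex_inner \<Rightarrow> 'a"
  assumes D: "bounded_clinear D" and sym: "\<And>x y. cinner (D x) y = cinner x (D y)"
    and pos: "\<And>x. 0 \<le> inner (D x) x"
    and roots: "\<And>t. t \<in> {0..onorm D} \<Longrightarrow> poly p (of_real t) \<noteq> 0"
  shows "\<exists>c>0. \<forall>x. c * norm x \<le> norm (poly_op D p x)"
  using roots
proof (induction "degree p" arbitrary: p)
  case 0
  then obtain a where a: "p = [:a:]" by (metis degree_eq_zeroE)
  have bl: "bounded_linear D" using D by (simp add: bounded_clinear_def)
  have "0 \<in> {0..onorm D}" using onorm_pos_le[OF bl] by simp
  then have "a \<noteq> 0" using "0.prems"[of 0] by (simp add: a)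
  then show ?case
    by (intro exI[of _ "cmod a"]) (simp add: poly_op_def a norm_scaleC)
next
  case (Suc k)
  have "\<exists>w. poly p w = 0"
    by (rule fundamental_theorem_of_algebra_alt) (use Suc.hyps(2) in auto)
  then obtain w q where p: "p = [:- w, 1:] * q" by (auto simp: poly_eq_0_iff_dvd)
  have w: "w \<notin> complex_of_real ` {0..onorm D}"
  proof
    assume "w \<in> complex_of_real ` {0..onorm D}"
    then obtain t where "t \<in> {0..onorm D}" "w = of_real t" by blast
    then show False using Suc.prems[of t] by (simp add: p)
  qed
  have "q \<noteq> 0" using Suc.hyps(2) p by auto
  then have "degree p = Suc (degree q)" unfolding p by (subst degree_mult_eq) auto
  then have "k = degree q" using Suc.hyps(2) by simp
  moreover have "poly q (of_real t) \<noteq> 0" if "t \<in> {0..onorm D}" for t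
    using Suc.prems[OF that] by (simp add: p)
  ultimately obtain c where c: "c > 0" "\<And>x. c * norm x \<le> norm (poly_op D q x)"
    using Suc.hyps(1)[of q] by blast
  obtain b where b: "b > 0" "\<And>x. b * norm x \<le> norm (D x - w *\<^sub>C x)"
    using positive_shift_bounded_below[OF D sym pos w] by blast
  have "b * c * norm x \<le> norm (poly_op D p x)" for x
  proof -
    have "b * (c * norm x) \<le> b * norm (poly_op D q x)" using b(1) c(2)[of x] by simp
    also have "\<dots> \<le> norm (D (poly_op D q x) - w *\<^sub>C poly_op D q x)" by (rule b(2))
    also have "\<dots> = norm (poly_op D p x)"
      unfolding p using D
      by (subst poly_op_linear_mult) (auto simp: bounded_clinear_def bounded_linear.linear linear_add)
    finally show ?thesis by (simp add: mult.assoc)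
  qed
  then show ?case using b(1) c(1) by (intro exI[of _ "b * c"]) simp
qed

text \<open>If the form were positive somewhere, \<open>p(D)\<close> would have approximate
  eigenvectors for some \<open>l > 0\<close>. But \<open>p - l\<close> has no zero on the interval,
  so it is bounded below at \<open>D\<close>.\<close>

lemma poly_op_nonpos:
  fixes D :: "'a::complex_inner \<Rightarrow> 'a"
  assumes D: "bounded_clinear D" and sym: "\<And>x y. cinner (D x) y = cinner x (D y)"
    and pos: "\<And>x. 0 \<le> inner (D x) x"
    and real: "\<And>i. coeff p i \<in> \<real>"
    and p: "\<And>t. t \<in> {0..onorm D} \<Longrightarrow> Re (poly p (of_real t)) \<le> 0"
  shows "inner (poly_op D p x) x \<le> 0"
proof (rule ccontr)
  assume neg: "\<not> ?thesis"
  have bl: "bounded_linear D" using D by (simp add: bounded_clinear_def)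
  define S where "S = poly_op D p"
  have "coeff p i *\<^sub>C y = Re (coeff p i) *\<^sub>R y" for i and y :: 'a
    using real[of i] by (simp flip: scaleC_of_real)
  then have S: "S = (\<lambda>x. \<Sum>i\<le>degree p. Re (coeff p i) *\<^sub>R (D ^^ i) x)"
    by (simp add: S_def fun_eq_iff poly_op_def)
  have rs: "inner (D x) y = inner x (D y)" for x y
    using sym[of x y] by (metis Re_cinner)
  have "bounded_linear S" unfolding S
    by (intro bounded_linear_sum bounded_linear_const_scaleR bounded_linear_funpow bl)
  moreover have "inner (S x) y = inner x (S y)" for x y
    unfolding S by (simp add: inner_sum_left inner_sum_right inner_funpow_adjoint[of D D, OF rs])
  moreover have "inner (S x) x > 0" using neg by (simp add: S_def)
  ultimately obtain l where l: "l > 0"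
    and ap: "\<And>e. e > 0 \<Longrightarrow> \<exists>z. norm z = 1 \<and> norm (S z - l *\<^sub>R z) < e"
    using approximate_top_eigenvector by blast
  define q where "q = p + monom (- complex_of_real l) 0"
  have "poly q (of_real t) \<noteq> 0" if "t \<in> {0..onorm D}" for t
  proof -
    have "Re (poly q (of_real t)) < 0" using p[OF that] l by (simp add: q_def poly_monom)
    then show ?thesis by auto
  qed
  then obtain c where c: "c > 0" "\<And>x. c * norm x \<le> norm (poly_op D q x)"
    using poly_op_bounded_below[OF D sym pos] by metis
  obtain z where z: "norm z = 1" "norm (S z - l *\<^sub>R z) < c" using ap[OF c(1)] by blast
  have "poly_op D q z = S z - l *\<^sub>R z"
    by (simp add: q_def poly_op_add poly_op_monom S_def scaleC_minus_left scaleC_of_real)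
  then show False using c(2)[of z] z by simp
qed

text \<open>Weierstrass: polynomials in \<open>D\<^sup>n\<close> approximate \<open>D\<close>, as polynomials in \<open>s\<close>
  approximate the \<open>n\<close>-th root of \<open>s\<close> uniformly.\<close>

lemma root_approximation:
  fixes D :: "'a::complex_inner \<Rightarrow> 'a"
  assumes D: "bounded_clinear D" and sym: "\<And>x y. cinner (D x) y = cinner x (D y)"
    and pos: "\<And>x. 0 \<le> inner (D x) x"
    and n: "n > 0" and e: "e > 0"
  obtains a :: "nat \<Rightarrow> real" and m
  where "\<And>x. \<bar>inner ((\<Sum>i\<le>m. a i *\<^sub>R (D ^^ (n * i)) x) - D x) x\<bar> \<le> e * (norm x)\<^sup>2"
proof -
  define R where "R = onorm D"
  have "continuous_on {0..R ^ n} (root n)" by (intro continuous_intros)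
  then obtain g where g: "real_polynomial_function g" "\<And>s. s \<in> {0..R ^ n} \<Longrightarrow> \<bar>root n s - g s\<bar> < e"
    using Stone_Weierstrass_real_polynomial_function[OF compact_Icc _ e] by metis
  obtain a m where am: "g = (\<lambda>s. \<Sum>i\<le>m. a i * s ^ i)"
    using g(1) unfolding real_polynomial_function_iff_sum by blast
  \<comment> \<open>At \<open>t\<close> this polynomial takes the value
    \<open>g (t ^ n) - t\<close>, which is within \<open>e\<close> of zero on the interval.\<close>
  define p where "p = (\<Sum>i\<le>m. monom (complex_of_real (a i)) (n * i)) - monom 1 1"
  have p_real: "coeff p i \<in> \<real>" for i
    unfolding p_def by (auto simp: coeff_sum intro!: sum_in_Reals)
  have p_le: "\<bar>Re (poly p (of_real t))\<bar> \<le> e" if "t \<in> {0..onorm D}" for t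
  proof -
    have "t ^ n \<in> {0..R ^ n}" using that by (auto simp: R_def intro: power_mono)
    moreover have "root n (t ^ n) = t" using that n by (simp add: real_root_power_cancel)
    moreover have "poly p (of_real t) = of_real (g (t ^ n) - t)"
      by (simp add: p_def poly_sum poly_monom am power_mult)
    ultimately show ?thesis using g(2)[of "t ^ n"] by simp
  qed
  have op: "poly_op D p x = (\<Sum>i\<le>m. a i *\<^sub>R (D ^^ (n * i)) x) - D x" for x
  proof -
    have "p = (\<Sum>i\<le>m. monom (complex_of_real (a i)) (n * i)) + monom (- 1) 1"
      by (simp add: p_def minus_monom)
    then show ?thesis
      by (simp add: poly_op_add poly_op_sum poly_op_monom scaleC_of_real scaleC_minus_left scaleC_one)
  qed
  \<comment> \<open>The two signs \<open>c = 1\<close> and \<open>c = -1\<close> give the absolute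
    value; for each, \<open>c * p - e\<close> is nonpositive on the interval.\<close>
  have half: "c * inner (poly_op D p x) x \<le> e * (norm x)\<^sup>2" if "\<bar>c\<bar> = 1" for c x
  proof -
    define q where "q = smult (of_real c) p + monom (- complex_of_real e) 0"
    have "inner (poly_op D q x) x \<le> 0"
    proof (rule poly_op_nonpos[OF D sym pos])
      show "coeff q i \<in> \<real>" for i
        using p_real[of i] by (auto simp: q_def)
      show "Re (poly q (of_real t)) \<le> 0" if "t \<in> {0..onorm D}" for t
      proof -
        have "c * Re (poly p (of_real t)) \<le> \<bar>c\<bar> * \<bar>Re (poly p (of_real t))\<bar>"
          by (metis abs_ge_self abs_mult)
        then show ?thesis using p_le[OF that] \<open>\<bar>c\<bar> = 1\<close> by (simp add: q_def poly_monom)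
      qed
    qed
    then show ?thesis
      by (simp add: q_def poly_op_add poly_op_smult poly_op_monom scaleC_minus_left scaleC_of_real
          inner_simps power2_norm_eq_inner)
  qed
  have "\<bar>inner (poly_op D p x) x\<bar> \<le> e * (norm x)\<^sup>2" for x
    using half[of 1 x] half[of "-1" x] by simp
  then show ?thesis using that unfolding op by blast
qed

text \<open>\<open>V\<close> is the adjoint of \<open>U\<close>, so \<open>y\<close> is the part of
  \<open>D (U x)\<close> orthogonal to the range. Polynomials in \<open>D ^^ n\<close> keep
  \<open>U x\<close> in the range; as they approximate \<open>D\<close>, the value
  \<open>inner (D (U x)) y\<close>, which is \<open>(norm y)^2\<close>, is arbitrarily
  small.\<close>

lemma range_invariant_of_power:
  fixes D :: "'a::complex_inner \<Rightarrow> 'a" and U :: "'b::real_inner \<Rightarrow> 'a"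
  assumes D: "bounded_clinear D" and sym: "\<And>x y. cinner (D x) y = cinner x (D y)"
    and pos: "\<And>x. 0 \<le> inner (D x) x" and n: "n > 0"
    and U: "bounded_linear U" and iso: "\<And>x y. inner (U x) (U y) = inner x y"
    and V: "\<And>x y. inner (U x) y = inner x (V y)"
    and X: "\<And>x. (D ^^ n) (U x) = U (X x)"
  shows "D (U x) \<in> range U"
proof -
  interpret U: bounded_linear U by fact
  have bl: "bounded_linear D" using D by (simp add: bounded_clinear_def)
  have rs: "inner (D x) y = inner x (D y)" for x y
    using sym[of x y] by (metis Re_cinner)
  define y where "y = D (U x) - U (V (D (U x)))"
  have orth: "inner (U h) y = 0" for h
    unfolding y_def inner_diff_right iso by (simp add: V)
  have yy: "inner (D (U x)) y = inner y y"
  proof -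
    have "inner y y = inner (D (U x)) y - inner (U (V (D (U x)))) y"
      by (subst (1) y_def) (rule inner_diff_left)
    then show ?thesis using orth by simp
  qed
  have DX: "(D ^^ (n * i)) (U x) = U ((X ^^ i) x)" for i
    using funpow_intertwine[of U X "D ^^ n" i x] X by (simp add: funpow_mult)
  have bound: "(norm y)\<^sup>2 \<le> e * ((norm (U x))\<^sup>2 + (norm y)\<^sup>2)" if e: "e > 0" for e
  proof -
    obtain a m where am:
      "\<And>z. \<bar>inner ((\<Sum>i\<le>m. a i *\<^sub>R (D ^^ (n * i)) z) - D z) z\<bar> \<le> e * (norm z)\<^sup>2"
      using root_approximation[OF D sym pos n e] by blast
    define S where "S z = (\<Sum>i\<le>m. a i *\<^sub>R (D ^^ (n * i)) z) - D z" for z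
    have "bounded_linear S" unfolding S_def
      by (intro bounded_linear_sub bounded_linear_sum bounded_linear_const_scaleR
          bounded_linear_funpow bl)
    then interpret S: bounded_linear S .
    have Ssym: "inner (S z) w = inner z (S w)" for z w
      by (simp add: S_def inner_diff_left inner_diff_right inner_sum_left inner_sum_right rs
          inner_funpow_adjoint[of D D, OF rs])
    have Sb: "\<bar>inner (S z) z\<bar> \<le> e * (norm z)\<^sup>2" for z unfolding S_def by (rule am)
    have "S (U x) = U (\<Sum>i\<le>m. a i *\<^sub>R (X ^^ i) x) - D (U x)"
      by (simp add: S_def DX U.sum U.scaleR)
    then have Sy: "inner (S (U x)) y = - (norm y)\<^sup>2"
      by (simp add: inner_diff_left orth yy power2_norm_eq_inner)
    \<comment> \<open>Polarisation: the approximation bounds only the quadratic form of the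
      symmetric \<open>S\<close>, while a mixed value is wanted.\<close>
    have "4 * inner (S (U x)) y = inner (S (U x + y)) (U x + y) - inner (S (U x - y)) (U x - y)"
      using Ssym[of "U x" y] by (simp add: S.add S.diff inner_simps inner_commute)
    then have "4 * (norm y)\<^sup>2 \<le> e * (norm (U x + y))\<^sup>2 + e * (norm (U x - y))\<^sup>2"
      using Sb[of "U x + y"] Sb[of "U x - y"] Sy by linarith
    also have "\<dots> = 2 * (e * ((norm (U x))\<^sup>2 + (norm y)\<^sup>2))"
      by (simp add: power2_norm_eq_inner inner_simps inner_commute algebra_simps)
    finally have "2 * (norm y)\<^sup>2 \<le> e * ((norm (U x))\<^sup>2 + (norm y)\<^sup>2)" by linarith
    then show ?thesis using zero_le_power2[of "norm y"] by linarith
  qed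
  define K where "K = (norm (U x))\<^sup>2 + (norm y)\<^sup>2"
  have K: "K \<ge> 0" by (simp add: K_def)
  have "(norm y)\<^sup>2 \<le> 0 + d" if "d > 0" for d
  proof -
    have "0 < d / (K + 1)" using that K by simp
    from bound[OF this] have "(norm y)\<^sup>2 \<le> d / (K + 1) * K" by (simp only: K_def)
    also have "\<dots> \<le> d" using that K by (simp add: divide_simps)
    finally show ?thesis by simp
  qed
  then have "(norm y)\<^sup>2 \<le> 0" by (rule field_le_epsilon)
  then have "D (U x) = U (V (D (U x)))" by (simp add: y_def)
  then show ?thesis by (rule range_eqI)
qed

section \<open>Powers of subnormal operators\<close>

lemma cadjoint_left:
  fixes T :: "'a::chilbert_space \<Rightarrow> 'b::chilbert_space"
  assumes "bounded_clinear T"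
  shows "cinner (cadjoint T x) y = cinner x (T y)"
  by (metis cadjoint[OF assms] cinner_commute)

theorem theorem4p1:
  fixes A T :: "'h::chilbert_space \<Rightarrow> 'h" and n \<kappa> :: nat
  assumes "subnormal_op TYPE('k::chilbert_space) A"
    and "n > 1" and "\<kappa> > 1"
    and "T = A ^^ n"
    and "(cadjoint T ^^ \<kappa>) \<circ> (T ^^ \<kappa>) = (cadjoint T \<circ> T) ^^ \<kappa>"
  shows "quasinormal_op A"
proof -
  obtain N :: "'k \<Rightarrow> 'k" and M U where N: "normal_op N" and UM: "unitary_onto U M"
    and UA: "\<And>x. U (A x) = N (U x)" and A: "bounded_clinear A"
    using assms(1) unfolding subnormal_op_def by blast
  have Nc: "bounded_clinear N" and comm: "cadjoint N \<circ> N = N \<circ> cadjoint N"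
    using N by (auto simp: normal_op_def)
  have Uc: "bounded_clinear U" and Ui: "\<And>x y. cinner (U x) (U y) = cinner x y"
    using UM by (auto simp: unitary_onto_def)
  have U: "bounded_linear U" using Uc by (simp add: bounded_clinear_def)
  have iso: "inner (U x) (U y) = inner x y" for x y
    using Ui[of x y] by (metis Re_cinner)
  have Uinj: "x = y" if "U x = U y" for x y
    by (rule cinner_ext) (metis Ui that)
  have Tc: "bounded_clinear T" unfolding assms(4) by (rule bounded_clinear_funpow[OF A])
  define D where "D = cadjoint N \<circ> N"
  have Dc: "bounded_clinear D"
    unfolding D_def by (intro bounded_clinear_compose bounded_clinear_cadjoint Nc)
  have Dsym: "cinner (D x) y = cinner x (D y)" for x y
    by (simp add: D_def cadjoint_left[OF Nc] flip: cadjoint[OF Nc])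
  have Dr: "inner (D x) y = inner x (D y)" for x y
    using Dsym[of x y] by (metis Re_cinner)
  have DN: "inner (D x) y = inner (N x) (N y)" for x y
    unfolding Dr by (simp add: D_def inner_cadjoint[OF Nc])
  have Dpos: "0 \<le> inner (D x) x" for x by (simp add: DN)
  \<comment> \<open>Normality lets the powers of \<open>N\<close> and of its adjoint pair off into a
    power of \<open>D\<close>.\<close>
  have Dpow: "inner ((D ^^ j) x) y = inner ((N ^^ j) x) ((N ^^ j) y)" for j x y
  proof -
    have "inner ((N ^^ j) x) ((N ^^ j) y) = inner x ((cadjoint N ^^ j) ((N ^^ j) y))"
      by (rule inner_funpow_adjoint[OF inner_cadjoint[OF Nc]])
    also have "(cadjoint N ^^ j) ((N ^^ j) y) = (D ^^ j) y"
      using fun_cong[OF funpow_comp_commute[OF comm, of j], of y] by (simp only: D_def o_apply)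
    finally show ?thesis by (simp only: inner_funpow_adjoint[of D D, OF Dr])
  qed
  define B where "B = D ^^ n"
  have Bsym: "inner (B x) y = inner x (B y)" for x y
    unfolding B_def by (rule inner_funpow_adjoint[OF Dr])
  have Bpos: "0 \<le> inner (B x) x" for x
    unfolding B_def by (rule power_positive[OF Dr Dpos])
  define G where "G j = (cadjoint T ^^ j) \<circ> (T ^^ j)" for j
  have Gc: "bounded_clinear (G j)" for j
    unfolding G_def
    by (intro bounded_clinear_compose bounded_clinear_funpow bounded_clinear_cadjoint Tc)
  \<comment> \<open>\<open>U\<close> carries \<open>T ^^ j\<close>, a power of \<open>A\<close>, to
    the same power of \<open>N\<close>, and \<open>Dpow\<close> applies there.\<close>
  have GB: "inner (G j x) y = inner ((B ^^ j) (U x)) (U y)" for j x y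
  proof -
    have Tj: "T ^^ j = A ^^ (n * j)" unfolding assms(4) by (rule funpow_mult)
    have "inner (G j x) y = inner y ((cadjoint T ^^ j) ((T ^^ j) x))"
      by (simp add: G_def inner_commute)
    also have "\<dots> = inner ((T ^^ j) y) ((T ^^ j) x)"
      by (rule inner_funpow_adjoint[OF inner_cadjoint[OF Tc], symmetric])
    also have "\<dots> = inner (U ((A ^^ (n * j)) x)) (U ((A ^^ (n * j)) y))"
      unfolding Tj iso by (rule inner_commute)
    also have "\<dots> = inner ((D ^^ (n * j)) (U x)) (U y)"
      unfolding funpow_intertwine[of U A N, OF UA] Dpow ..
    finally show ?thesis by (simp add: B_def funpow_mult)
  qed
  define Y where "Y = cadjoint T \<circ> T"
  have YB: "inner (Y x) y = inner (B (U x)) (U y)" for x y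
    using GB[of 1 x y] by (simp add: G_def Y_def)
  have Yc: "bounded_clinear Y"
    unfolding Y_def by (intro bounded_clinear_compose bounded_clinear_cadjoint Tc)
  have "B (U x) = U (Y x)" for x
  proof (rule intertwine_of_power_le[where B = B and U = U and Y = Y and G = G and k = \<kappa>])
    show "bounded_linear Y" "\<And>j. bounded_linear (G j)"
      using Yc Gc by (auto simp: bounded_clinear_def)
    show "bounded_linear B" unfolding B_def
      using bounded_linear_funpow Dc by (auto simp: bounded_clinear_def)
    show "2 \<le> \<kappa>" using assms(3) by simp
    \<comment> \<open>The equation assumed for \<open>T\<close> enters here, as an inequality
      between quadratic forms.\<close>
    show "inner ((B ^^ \<kappa>) (U x)) (U x) \<le> inner ((Y ^^ \<kappa>) x) x" for x
      unfolding GB[symmetric] G_def Y_def assms(5) by simp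
  qed (use Bsym Bpos U iso YB GB in blast)+
  then have "D (U x) \<in> range U" for x
    using range_invariant_of_power[OF Dc Dsym Dpos _ U iso inner_cadjoint[OF Uc], of n Y x] assms(2)
    by (simp add: B_def)
  then have "\<forall>x. \<exists>w. D (U x) = U w" by blast
  then obtain W where W: "\<And>x. D (U x) = U (W x)" by metis
  \<comment> \<open>Invariance of the range gives some \<open>W\<close>; since \<open>U\<close> is
    isometric and carries \<open>A\<close> to \<open>N\<close>, pairing with \<open>z\<close>
    identifies it.\<close>
  have "W x = (cadjoint A \<circ> A) x" for x
  proof (rule cinner_ext)
    fix z
    have "cinner z (W x) = cinner (U z) (D (U x))" by (simp add: W Ui)
    also have "\<dots> = cinner (N (U z)) (N (U x))" by (simp add: D_def cadjoint[OF Nc])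
    also have "\<dots> = cinner z ((cadjoint A \<circ> A) x)"
      by (simp add: Ui cadjoint[OF A] flip: UA)
    finally show "cinner z (W x) = cinner z ((cadjoint A \<circ> A) x)" .
  qed
  then have DU: "D (U x) = U ((cadjoint A \<circ> A) x)" for x by (simp add: W)
  have ND: "N (D v) = D (N v)" for v
    using fun_cong[OF comm, of "N v"] by (simp add: D_def)
  \<comment> \<open>The commutation of \<open>N\<close> with \<open>D\<close> is pulled back along
    the injective \<open>U\<close>.\<close>
  have "A ((cadjoint A \<circ> A) x) = (cadjoint A \<circ> A) (A x)" for x
    by (rule Uinj) (simp only: UA ND flip: DU)
  then show ?thesis using A by (simp add: quasinormal_op_def fun_eq_iff)
qed

end
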